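(* Over the field $GF(2)$ there is an absolute constant $C$ such that for every $n\ge 1$, every bilinear circuit over $GF(2)$ that computes the product of two $n\times n$ matrices has at least $3n^2 - C n^{5/3}$ product gates. Equivalently, the bilinear rank over $GF(2)$ of the $n^2$ bilinear forms $\{\sum_{k=1}^n x_{i,k}y_{k,j}\}_{1\le i,j\le n}$ is at least $3n^2 - Cn^{5/3}$.
   Context: The inputs are two $n\times n$ matrices of variables $x=(x_{i,j})$, $y=(y_{i,j})$, and the $n^2$ outputs are the entries $(x\cdot y)_{i,j}=\sum_{k=1}^n x_{i,k}y_{k,j}$. An arithmetic circuit over a field $F$ is a directed acyclic graph whose in-degree-0 nodes are labeled by input variables, whose edges are labeled by field constants, and whose other nodes are sum gates or product gates; a node computes the sum (resp. product) of the values of its in-neighbours, each multiplied by the constant on the connecting edge. A bilinear circuit is an arithmetic circuit in which every product gate multiplies exactly two linear forms, the first a linear form in the variables of $x$ only and the second a linear form in the variables of $y$ only. The bilinear rank of a set of bilinear forms in $x,y$ is the smallest number of products $\mu(x)\eta(y)$ (with $\mu$ linear in $x$, $\eta$ linear in $y$) whose linear span contains all of the forms. *)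

theory Defs
  imports
    Complex_Main
    "HOL-Library.Z2"
    "HOL-Library.Poly_Mapping"
    "Graph_Theory.Digraph"
begin

section \<open>Polynomials\<close>

text \<open>Formal polynomials with variables in \<open>'v\<close>: finitely supported maps from monomials
  (finitely supported exponent vectors) to coefficients.  Over \<open>GF(2)\<close> these are distinct from
  polynomial functions.\<close>

type_synonym ('v, 'f) mpolynomial = "('v \<Rightarrow>\<^sub>0 nat) \<Rightarrow>\<^sub>0 'f"

definition pvar :: "'v \<Rightarrow> ('v, 'f::field) mpolynomial" where
  "pvar z = Poly_Mapping.single (Poly_Mapping.single z 1) 1"

definition pscale :: "'f::field \<Rightarrow> ('v, 'f) mpolynomial \<Rightarrow> ('v, 'f) mpolynomial" where
  "pscale c p = Poly_Mapping.single 0 c * p"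

interpretation mpoly: vector_space "pscale :: 'f::field \<Rightarrow> ('v, 'f) mpolynomial \<Rightarrow> _"
proof
  fix a b :: 'f and p q :: "('v, 'f) mpolynomial"
  show "pscale a (p + q) = pscale a p + pscale a q"
    by (simp add: pscale_def algebra_simps)
  show "pscale (a + b) p = pscale a p + pscale b p"
    by (simp add: pscale_def single_add algebra_simps)
  show "pscale a (pscale b p) = pscale (a * b) p"
    by (simp add: pscale_def mult_single flip: mult.assoc)
  show "pscale 1 p = p"
    by (simp add: pscale_def)
qed

definition linear_form_in :: "'v set \<Rightarrow> ('v, 'f::field) mpolynomial \<Rightarrow> bool" where
  "linear_form_in V p \<longleftrightarrow> p \<in> mpoly.span (pvar ` V)"


section \<open>Arithmetic circuits\<close>

datatype 'v node_label = Input 'v | SumGate | ProdGate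

text \<open>Parallel arcs are allowed, so that a node may enter the same gate several times.\<close>

record ('a, 'b, 'v, 'f) circuit =
  dag :: "('a, 'b) pre_digraph"
  label :: "'a \<Rightarrow> 'v node_label"
  const :: "'b \<Rightarrow> 'f"

definition arith_circuit :: "'v set \<Rightarrow> ('a, 'b, 'v, 'f::field) circuit \<Rightarrow> bool" where
  "arith_circuit V G \<longleftrightarrow>
     fin_digraph (dag G) \<and> acyclic (arcs_ends (dag G)) \<and>
     (\<forall>v\<in>verts (dag G).
        if in_arcs (dag G) v = {} then label G v \<in> Input ` V
        else label G v \<in> {SumGate, ProdGate})"

text \<open>The polynomial computed at a node, by recursion along the arcs; the recursion equation is
  \<open>node_poly_eq\<close> below.\<close>

definition node_poly ::
    "('a, 'b, 'v, 'f::field) circuit \<Rightarrow> 'a \<Rightarrow> ('v, 'f) mpolynomial" where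
  "node_poly G = wfrec (arcs_ends (dag G)) (\<lambda>val v.
     case label G v of
       Input z \<Rightarrow> pvar z
     | SumGate \<Rightarrow> \<Sum>e\<in>in_arcs (dag G) v. pscale (const G e) (val (tail (dag G) e))
     | ProdGate \<Rightarrow> \<Prod>e\<in>in_arcs (dag G) v. pscale (const G e) (val (tail (dag G) e)))"

lemma node_poly_eq:
  fixes G :: "('a, 'b, 'v, 'f::field) circuit"
  assumes "arith_circuit V G"
  shows "node_poly G v =
    (case label G v of
       Input z \<Rightarrow> pvar z
     | SumGate \<Rightarrow> \<Sum>e\<in>in_arcs (dag G) v. pscale (const G e) (node_poly G (tail (dag G) e))
     | ProdGate \<Rightarrow> \<Prod>e\<in>in_arcs (dag G) v. pscale (const G e) (node_poly G (tail (dag G) e)))"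
proof -
  let ?R = "arcs_ends (dag G)"
  interpret fin_digraph "dag G" using assms by (simp add: arith_circuit_def)
  have "finite ?R" by (simp add: arcs_ends_def)
  then have wf: "wf ?R" using assms by (simp add: arith_circuit_def finite_acyclic_wf)
  have cut: "cut f ?R v (tail (dag G) e) = f (tail (dag G) e)" if "e \<in> in_arcs (dag G) v"
    for e and f :: "'a \<Rightarrow> ('v, 'f) mpolynomial"
    using that by (intro cut_apply) (auto simp: arcs_ends_conv)
  show ?thesis
    by (subst node_poly_def, subst wfrec[OF wf], fold node_poly_def)
       (simp add: cut split: node_label.split)
qed

text \<open>The factors entering a product gate are the values of the in-neighbours multiplied by the
  constants on the arcs.\<close>

definition bilinear_circuit :: "'v set \<Rightarrow> 'v set \<Rightarrow> ('a, 'b, 'v, 'f::field) circuit \<Rightarrow> bool" where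
  "bilinear_circuit X Y G \<longleftrightarrow>
     arith_circuit (X \<union> Y) G \<and>
     (\<forall>v\<in>verts (dag G). label G v = ProdGate \<longrightarrow>
        (\<exists>e e'. e \<noteq> e' \<and> in_arcs (dag G) v = {e, e'} \<and>
           linear_form_in X (pscale (const G e) (node_poly G (tail (dag G) e))) \<and>
           linear_form_in Y (pscale (const G e') (node_poly G (tail (dag G) e')))))"

definition computes ::
    "('a, 'b, 'v, 'f::field) circuit \<Rightarrow> ('v, 'f) mpolynomial set \<Rightarrow> bool" where
  "computes G F \<longleftrightarrow> F \<subseteq> node_poly G ` verts (dag G)"

definition num_prod_gates :: "('a, 'b, 'v, 'f) circuit \<Rightarrow> nat" where
  "num_prod_gates G = card {v \<in> verts (dag G). label G v = ProdGate}"


section \<open>Bilinear rank\<close>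

definition bilinear_products :: "'v set \<Rightarrow> 'v set \<Rightarrow> ('v, 'f::field) mpolynomial set" where
  "bilinear_products X Y = {\<mu> * \<eta> | \<mu> \<eta>. linear_form_in X \<mu> \<and> linear_form_in Y \<eta>}"

definition bilinear_rank ::
    "'v set \<Rightarrow> 'v set \<Rightarrow> ('v, 'f::field) mpolynomial set \<Rightarrow> nat" where
  "bilinear_rank X Y F =
     (LEAST r. \<exists>P. P \<subseteq> bilinear_products X Y \<and> finite P \<and> card P = r \<and> F \<subseteq> mpoly.span P)"


section \<open>Matrix product\<close>

datatype mat_var = XVar nat nat | YVar nat nat

definition x_vars :: "nat \<Rightarrow> mat_var set" where
  "x_vars n = {XVar i j | i j. i \<in> {1..n} \<and> j \<in> {1..n}}"

definition y_vars :: "nat \<Rightarrow> mat_var set" where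
  "y_vars n = {YVar i j | i j. i \<in> {1..n} \<and> j \<in> {1..n}}"

definition mat_prod_entry :: "nat \<Rightarrow> nat \<Rightarrow> nat \<Rightarrow> (mat_var, 'f::field) mpolynomial" where
  "mat_prod_entry n i j = (\<Sum>k=1..n. pvar (XVar i k) * pvar (YVar k j))"

definition mat_prod_forms :: "nat \<Rightarrow> (mat_var, 'f::field) mpolynomial set" where
  "mat_prod_forms n = {mat_prod_entry n i j | i j. i \<in> {1..n} \<and> j \<in> {1..n}}"

text \<open>The minimum defining the rank of the matrix product is over a nonempty set.\<close>

lemma mat_prod_forms_finite_rank:
  "\<exists>P. P \<subseteq> bilinear_products (x_vars n) (y_vars n) \<and> finite P \<and>
       (mat_prod_forms n :: (mat_var, 'f::field) mpolynomial set) \<subseteq> mpoly.span P"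
proof -
  let ?f = "\<lambda>(i, k, j). pvar (XVar i k) * pvar (YVar k j) :: (mat_var, 'f) mpolynomial"
  let ?P = "?f ` ({1..n} \<times> {1..n} \<times> {1..n})"
  have "?P \<subseteq> bilinear_products (x_vars n) (y_vars n)"
    by (fastforce simp: bilinear_products_def linear_form_in_def x_vars_def y_vars_def
        intro: mpoly.span_base)
  moreover have "mat_prod_forms n \<subseteq> mpoly.span ?P"
    unfolding mat_prod_forms_def mat_prod_entry_def
    by (clarsimp, intro mpoly.span_sum mpoly.span_base) force
  ultimately show ?thesis by blast
qed

end

theory Submission
  imports Defs "HOL-Library.Cardinality" "Jordan_Normal_Form.Determinant"
begin

text \<open>
  Over a field with \<open>q\<close> elements let \<open>\<mu>\<^sub>p(X) \<eta>\<^sub>p(Y)\<close>, \<open>p \<in> P\<close>, be the products. If a matrix \<open>Z\<close> has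
  \<open>r\<close> independent columns, at least \<open>n r\<close> of the \<open>\<mu>\<^sub>p\<close> are nonzero at \<open>Z\<close>, since otherwise \<open>Z Y = 0\<close>
  for some \<open>Y \<noteq> 0\<close> supported in the corresponding \<open>r\<close> rows.

  A minimal subset \<open>B \<subseteq> P\<close> such that the \<open>\<mu>\<^sub>b\<close>, \<open>b \<in> B\<close>, separate matrices has at least \<open>n\<^sup>2\<close> elements
  and a dual family of matrices, in which every matrix can be expanded. Expand the first \<open>d\<close> powers
  of the nilpotent shift and multiply each term by a variable with values in \<open>{0, 1}\<close>. The product,
  over all nonzero linear combinations of these \<open>d\<close> matrices, of suitable \<open>(n - d)\<close>-minors has
  degree at most \<open>(q\<^sup>d - 1) (n - d)\<close> and is nonzero where all variables are \<open>1\<close>; hence it is nonzero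
  at a point with at most \<open>(q\<^sup>d - 1) (n - d)\<close> ones. The \<open>d\<close>-dimensional space \<open>L\<close> of matrices
  obtained is annihilated by all but \<open>(q\<^sup>d - 1) (n - d)\<close> of the \<open>\<mu>\<^sub>b\<close>, \<open>b \<in> B\<close>, and all its nonzero
  elements have \<open>n - d\<close> independent columns.

  Every \<open>\<mu>\<^sub>p\<close> vanishes on at least \<open>1/q\<close> of \<open>L\<close>, so Plotkin's averaging argument on the products not
  annihilating \<open>L\<close> gives \<open>|P| - n\<^sup>2 + n (q\<^sup>d - 1) \<ge> q / (q - 1) (1 - q\<^bsup>-d\<^esup>) n (n - d)\<close>. With \<open>q\<^sup>d\<close> of
  order \<open>\<surd>n\<close> the rank is at least \<open>(2 + 1 / (q - 1)) n\<^sup>2 - O(n\<^bsup>3/2\<^esup>)\<close>, that is,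
  \<open>3 n\<^sup>2 - O(n\<^bsup>3/2\<^esup>)\<close> for \<open>q = 2\<close>.
\<close>

section \<open>Functions of bounded degree on the cube\<close>

text \<open>A point of \<open>{0, 1}\<^sup>V\<close> is encoded by its support \<open>Q\<close>; the monomial \<open>\<Prod>x\<in>M. x\<close> is then
  \<open>M \<subseteq> Q\<close>.\<close>

inductive degree_le :: "nat \<Rightarrow> ('a set \<Rightarrow> 'f::comm_ring_1) \<Rightarrow> bool" for D where
  monomial: "finite M \<Longrightarrow> card M \<le> D \<Longrightarrow> degree_le D (\<lambda>Q. c * of_bool (M \<subseteq> Q))"
| add: "degree_le D f \<Longrightarrow> degree_le D g \<Longrightarrow> degree_le D (\<lambda>Q. f Q + g Q)"

lemma degree_le_const: "degree_le D (\<lambda>_. c)"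
  using degree_le.monomial[of "{}" D c] by simp

lemma degree_le_variable_mult_const: "degree_le 1 (\<lambda>Q. of_bool (x \<in> Q) * c)"
  using degree_le.monomial[of "{x}" 1 c] by (simp add: mult.commute)

lemma degree_le_mult:
  assumes "degree_le D f" "degree_le E g"
  shows "degree_le (D + E) (\<lambda>Q. f Q * g Q)"
  using assms(1)
proof (induction rule: degree_le.induct)
  case (monomial M c)
  from assms(2) show ?case
  proof (induction rule: degree_le.induct)
    case (monomial N c')
    have "card (M \<union> N) \<le> D + E"
      using card_Un_le[of M N] \<open>card M \<le> D\<close> \<open>card N \<le> E\<close> by linarith
    then have "degree_le (D + E) (\<lambda>Q. (c * c') * of_bool (M \<union> N \<subseteq> Q))"
      using \<open>finite M\<close> \<open>finite N\<close> by (intro degree_le.monomial) auto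
    then show ?case by (simp add: of_bool_conj mult_ac)
  next
    case (add g1 g2)
    then show ?case by (simp only: distrib_left degree_le.add)
  qed
next
  case (add f1 f2)
  then show ?case by (simp only: distrib_right degree_le.add)
qed

lemma degree_le_const_mult:
  assumes "degree_le D f"
  shows "degree_le D (\<lambda>Q. c * f Q)"
  using degree_le_mult[OF degree_le_const[of 0 c] assms] by simp

lemma degree_le_sum:
  assumes "\<And>i. i \<in> I \<Longrightarrow> degree_le D (f i)"
  shows "degree_le D (\<lambda>Q. \<Sum>i\<in>I. f i Q)"
  using assms
  by (induction I rule: infinite_finite_induct) (auto intro: degree_le_const degree_le.add)

lemma degree_le_prod:
  assumes "finite I" "\<And>i. i \<in> I \<Longrightarrow> degree_le D (f i)"
  shows "degree_le (card I * D) (\<lambda>Q. \<Prod>i\<in>I. f i Q)"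
  using assms
proof (induction I)
  case empty
  then show ?case by (simp add: degree_le_const)
next
  case (insert x I)
  then show ?case by (auto intro: degree_le_mult)
qed

lemma degree_le_det:
  assumes "\<And>i j. i < m \<Longrightarrow> j < m \<Longrightarrow> degree_le 1 (f i j)"
  shows "degree_le m (\<lambda>Q. det (mat m m (\<lambda>(i, j). f i j Q)))"
proof -
  have "degree_le (card {0..<m} * 1) (\<lambda>Q. \<Prod>i = 0..<m. f i (p i) Q)"
    if "p permutes {0..<m}" for p
    using permutes_in_image[OF that] by (intro degree_le_prod assms) auto
  then have "degree_le m (\<lambda>Q. \<Sum>p\<in>{p. p permutes {0..<m}}.
      signof p * (\<Prod>i = 0..<m. f i (p i) Q))"
    by (intro degree_le_sum degree_le_const_mult) auto
  moreover have "det (mat m m (\<lambda>(i, j). f i j Q)) = (\<Sum>p\<in>{p. p permutes {0..<m}}.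
      signof p * (\<Prod>i = 0..<m. f i (p i) Q))" for Q
    unfolding det_def using permutes_in_image
    by (fastforce intro!: sum.cong prod.cong arg_cong2[where f = "(*)"])
  ultimately show ?thesis by simp
qed

lemma alternating_sum_supersets_eq_0:
  assumes "finite S" "U \<subset> S"
  shows "(\<Sum>Q\<in>{Q. Q \<subseteq> S \<and> U \<subseteq> Q}. (- 1) ^ card Q) = (0 :: 'f::ring_1)"
  using card_subsupersets_even_odd[OF assms] \<open>finite S\<close>
  by (intro sum_alternating_cancels) auto

lemma alternating_sum_degree_le_eq_0:
  fixes f :: "'a set \<Rightarrow> 'f::comm_ring_1"
  assumes "degree_le D f" "finite S" "D < card S"
  shows "(\<Sum>Q\<in>Pow S. (- 1) ^ card Q * f Q) = 0"
  using assms(1)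
proof (induction rule: degree_le.induct)
  case (monomial M c)
  have "(\<Sum>Q\<in>Pow S. (- 1) ^ card Q * (c * of_bool (M \<subseteq> Q)))
      = (\<Sum>Q\<in>{Q. Q \<subseteq> S \<and> M \<subseteq> Q}. (- 1) ^ card Q * c)"
    using assms(2) by (intro sum.mono_neutral_cong_right) auto
  also have "\<dots> = (\<Sum>Q\<in>{Q. Q \<subseteq> S \<and> M \<subseteq> Q}. (- 1) ^ card Q) * c"
    by (simp add: sum_distrib_right)
  also have "\<dots> = 0"
  proof (cases "M \<subseteq> S")
    case True
    then have "M \<subset> S" using monomial assms(3) by auto
    then show ?thesis by (simp add: alternating_sum_supersets_eq_0[OF assms(2)])
  next
    case False
    then have "{Q. Q \<subseteq> S \<and> M \<subseteq> Q} = {}" by auto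
    then show ?thesis by (simp only: sum.empty mult_zero_left)
  qed
  finally show ?case .
next
  case (add f g)
  then show ?case by (simp add: distrib_left sum.distrib)
qed

text \<open>At a nonzero point of minimal weight \<open>> D\<close>, the alternating sum over the subcube below it
  would be nonzero.\<close>

lemma degree_le_obtain_small_nonzero:
  fixes f :: "'a set \<Rightarrow> 'f::comm_ring_1"
  assumes "degree_le D f" "finite S" "f S \<noteq> 0"
  obtains A where "A \<subseteq> S" "card A \<le> D" "f A \<noteq> 0"
proof -
  have "\<exists>A. A \<subseteq> S \<and> card A \<le> D \<and> f A \<noteq> 0"
    using assms(2,3)
  proof (induction S rule: finite_psubset_induct)
    case (psubset S)
    show ?case
    proof (rule ccontr)
      assume no_small: "\<not> ?case"
      then have "f Q = 0" if "Q \<subset> S" for Q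
        using psubset.IH[of Q] that by blast
      then have "(\<Sum>Q\<in>Pow S - {S}. (- 1) ^ card Q * f Q) = 0"
        by (intro sum.neutral) (auto simp: psubset_eq)
      moreover have "(\<Sum>Q\<in>Pow S. (- 1) ^ card Q * f Q) = 0"
        using no_small psubset.prems
        by (intro alternating_sum_degree_le_eq_0[OF assms(1) psubset.hyps]) (auto simp: not_le)
      ultimately have "(- 1) ^ card S * f S = 0"
        using psubset.hyps sum.remove[of "Pow S" S "\<lambda>Q. (- 1) ^ card Q * f Q"] by simp
      then show False
        using psubset.prems by (cases "even (card S)") simp_all
    qed
  qed
  then show ?thesis using that by blast
qed

lemma degree_le_obtain_small_common_nonzero:
  fixes f :: "'c \<Rightarrow> 'a set \<Rightarrow> 'f::idom"
  assumes "finite C" "\<And>c. c \<in> C \<Longrightarrow> degree_le D (f c)"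
    and "finite S" "\<And>c. c \<in> C \<Longrightarrow> f c S \<noteq> 0"
  obtains A where "A \<subseteq> S" "card A \<le> card C * D" "\<And>c. c \<in> C \<Longrightarrow> f c A \<noteq> 0"
proof -
  have degree: "degree_le (card C * D) (\<lambda>Q. \<Prod>c\<in>C. f c Q)"
    using assms(1,2) by (rule degree_le_prod)
  have nonzero: "(\<Prod>c\<in>C. f c S) \<noteq> 0"
    using assms(1,4) by simp
  obtain A where "A \<subseteq> S" "card A \<le> card C * D" "(\<Prod>c\<in>C. f c A) \<noteq> 0"
    by (rule degree_le_obtain_small_nonzero[OF degree assms(3) nonzero])
  then show ?thesis using that assms(1) by simp
qed

section \<open>Separating families of linear functionals\<close>

definition dot :: "'x set \<Rightarrow> ('x \<Rightarrow> 'f::comm_ring_1) \<Rightarrow> ('x \<Rightarrow> 'f) \<Rightarrow> 'f" where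
  "dot I u Z = (\<Sum>x\<in>I. u x * Z x)"

lemma dot_sum_right: "dot I u (\<lambda>x. \<Sum>i\<in>S. a i * f i x) = (\<Sum>i\<in>S. a i * dot I u (f i))"
proof -
  have "dot I u (\<lambda>x. \<Sum>i\<in>S. a i * f i x) = (\<Sum>x\<in>I. \<Sum>i\<in>S. a i * (u x * f i x))"
    by (simp add: dot_def sum_distrib_left mult.left_commute)
  also have "\<dots> = (\<Sum>i\<in>S. a i * dot I u (f i))"
    by (subst sum.swap) (simp add: dot_def sum_distrib_left)
  finally show ?thesis .
qed

lemma dot_diff_right: "dot I u (\<lambda>x. f x - g x) = dot I u f - dot I u g"
  by (simp add: dot_def right_diff_distrib sum_subtractf)

lemma dot_divide_right:
  fixes c :: "'f::field"
  shows "dot I u (\<lambda>x. f x / c) = dot I u f / c"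
  by (simp add: dot_def sum_divide_distrib)

lemma obtain_nonzero_orthogonal:
  fixes u :: "'p \<Rightarrow> 'x \<Rightarrow> 'f::field"
  assumes "finite I" "finite K" "card K < card I"
  obtains Z where "\<exists>x\<in>I. Z x \<noteq> 0" "\<And>p. p \<in> K \<Longrightarrow> dot I (u p) Z = 0"
proof -
  obtain e g where e: "bij_betw e {0..<card I} I" and g: "bij_betw g {0..<card K} K"
    using assms ex_bij_betw_nat_finite by metis
  let ?m = "card I"
  let ?A = "mat ?m ?m (\<lambda>(i, j). if i < card K then u (g i) (e j) else 0)"
  have "det ?A = (\<Sum>j<?m. ?A $$ (card K, j) * cofactor ?A (card K) j)"
    using assms(3) by (intro laplace_expansion_row) auto
  also have "\<dots> = 0"
    using assms(3) by (intro sum.neutral) auto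
  finally obtain z where z: "z \<in> carrier_vec ?m" "z \<noteq> 0\<^sub>v ?m" "?A *\<^sub>v z = 0\<^sub>v ?m"
    using det_0_iff_vec_prod_zero[of ?A ?m] by auto
  define Z where "Z x = z $ the_inv_into {0..<?m} e x" for x
  have Z_e: "Z (e j) = z $ j" if "j < ?m" for j
    using that e by (simp add: Z_def the_inv_into_f_f bij_betw_def)
  obtain j where "j < ?m" "z $ j \<noteq> 0"
    using z(1,2) by (metis carrier_vecD eq_vecI index_zero_vec)
  then have "\<exists>x\<in>I. Z x \<noteq> 0"
    using e Z_e by (metis bij_betwE atLeast0LessThan lessThan_iff)
  moreover have "dot I (u p) Z = 0" if p: "p \<in> K" for p
  proof -
    obtain i where i: "i < card K" "p = g i"
      using p bij_betw_imp_surj_on[OF g] by force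
    have "dot I (u p) Z = (\<Sum>j = 0..<?m. u (g i) (e j) * Z (e j))"
      unfolding dot_def i(2) by (rule sum.reindex_bij_betw[OF e, symmetric])
    also have "\<dots> = (?A *\<^sub>v z) $ i"
      using i(1) assms(3) z(1) by (auto simp: scalar_prod_def Z_e)
    also have "\<dots> = 0"
      using i(1) assms(3) z(3) by simp
    finally show ?thesis .
  qed
  ultimately show ?thesis using that by blast
qed

definition separating :: "'x set \<Rightarrow> ('p \<Rightarrow> 'x \<Rightarrow> 'f::comm_ring_1) \<Rightarrow> 'p set \<Rightarrow> bool" where
  "separating I u S \<longleftrightarrow> (\<forall>Z. (\<forall>p\<in>S. dot I (u p) Z = 0) \<longrightarrow> (\<forall>x\<in>I. Z x = 0))"

definition dual_family ::
    "'x set \<Rightarrow> ('p \<Rightarrow> 'x \<Rightarrow> 'f::comm_ring_1) \<Rightarrow> 'p set \<Rightarrow> ('p \<Rightarrow> 'x \<Rightarrow> 'f) \<Rightarrow> bool" where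
  "dual_family I u B E \<longleftrightarrow> (\<forall>b\<in>B. \<forall>p\<in>B. dot I (u p) (E b) = of_bool (b = p))"

lemma card_le_card_separating:
  fixes u :: "'p \<Rightarrow> 'x \<Rightarrow> 'f::field"
  assumes "finite I" "finite S" "separating I u S"
  shows "card I \<le> card S"
proof (rule ccontr)
  assume "\<not> ?thesis"
  then obtain Z where "\<exists>x\<in>I. Z x \<noteq> 0" "\<And>p. p \<in> S \<Longrightarrow> dot I (u p) Z = 0"
    using obtain_nonzero_orthogonal[of I S u] assms(1,2) by auto
  then show False using assms(3) by (auto simp: separating_def)
qed

lemma obtain_separating_dual_family:
  fixes u :: "'p \<Rightarrow> 'x \<Rightarrow> 'f::field"
  assumes "finite P" "separating I u P"
  obtains B E where "B \<subseteq> P" "separating I u B" "dual_family I u B E"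
proof -
  obtain B where B: "B \<subseteq> P" "separating I u B"
    and minimal: "\<And>S. S \<subseteq> P \<Longrightarrow> separating I u S \<Longrightarrow> card B \<le> card S"
    using ex_has_least_nat[of "\<lambda>S. S \<subseteq> P \<and> separating I u S" P card] assms(2) by auto
  have "\<exists>Z. \<forall>p\<in>B. dot I (u p) Z = of_bool (b = p)" if "b \<in> B" for b
  proof -
    have "card (B - {b}) < card B"
      using that B(1) assms(1) by (intro card_Diff1_less) (auto intro: finite_subset)
    then have "\<not> separating I u (B - {b})"
      using minimal[of "B - {b}"] B(1) by auto
    then obtain Z x where Z: "\<And>p. p \<in> B - {b} \<Longrightarrow> dot I (u p) Z = 0" "x \<in> I" "Z x \<noteq> 0"
      unfolding separating_def by blast
    then have "dot I (u b) Z \<noteq> 0"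
      using B(2) unfolding separating_def by (metis DiffI singletonD)
    then show ?thesis
      using Z(1) by (intro exI[of _ "\<lambda>x. Z x / dot I (u b) Z"]) (auto simp: dot_divide_right)
  qed
  then obtain E where "dual_family I u B E"
    unfolding dual_family_def by metis
  then show ?thesis using that B by blast
qed

lemma dual_family_expansion:
  assumes "finite B" "separating I u B" "dual_family I u B E" "x \<in> I"
  shows "(\<Sum>b\<in>B. dot I (u b) Z * E b x) = Z x"
proof -
  have "dot I (u p) (\<lambda>x. Z x - (\<Sum>b\<in>B. dot I (u b) Z * E b x)) = 0" if "p \<in> B" for p
    using that assms(1,3) by (simp add: dot_diff_right dot_sum_right dual_family_def)
  then have "Z x - (\<Sum>b\<in>B. dot I (u b) Z * E b x) = 0"
    using assms(2,4) unfolding separating_def by blast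
  then show ?thesis by simp
qed

section \<open>Sparse spaces of nonsingular blocks\<close>

abbreviation entries :: "nat \<Rightarrow> (nat \<times> nat) set" where
  "entries n \<equiv> {..<n} \<times> {..<n}"

definition top_block :: "nat \<Rightarrow> nat \<Rightarrow> (nat \<times> nat \<Rightarrow> 'f) \<Rightarrow> 'f mat" where
  "top_block s m Z = mat m m (\<lambda>(i, k). Z (i, s + k))"

definition shift_matrix :: "nat \<Rightarrow> nat \<times> nat \<Rightarrow> 'f::zero_neq_one" where
  "shift_matrix i = (\<lambda>(a, b). of_bool (b = a + i))"

text \<open>Cutting off the columns before the first nonzero diagonal leaves an upper triangular block
  with constant diagonal.\<close>

lemma det_top_block_shift_combination:
  fixes c :: "nat \<Rightarrow> 'f::comm_ring_1"
  assumes "s < d" "\<And>i. i < s \<Longrightarrow> c i = 0"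
  shows "det (top_block s m (\<lambda>x. \<Sum>i<d. c i * shift_matrix i x)) = c s ^ m"
    (is "det ?M = _")
proof -
  have "(\<Sum>i<d. c i * shift_matrix i (a, s + k)) = 0" if "k < a" for a k
    using that assms(2) by (intro sum.neutral) (auto simp: shift_matrix_def)
  then have "upper_triangular ?M"
    by (auto simp: upper_triangular_def top_block_def)
  then have "det ?M = prod_list (diag_mat ?M)"
    by (intro det_upper_triangular[of _ m]) (simp_all add: top_block_def)
  also have "diag_mat ?M = replicate m (c s)"
    using assms(1)
    by (intro nth_equalityI)
      (simp_all add: diag_mat_def top_block_def shift_matrix_def eq_commute[of s])
  finally show ?thesis by simp
qed

definition nonzero_tuples :: "'i set \<Rightarrow> ('i \<Rightarrow> 'f::zero) set" where
  "nonzero_tuples J = {c \<in> J \<rightarrow>\<^sub>E UNIV. \<exists>i\<in>J. c i \<noteq> 0}"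

lemma finite_nonzero_tuples:
  assumes "finite J"
  shows "finite (nonzero_tuples J :: ('i \<Rightarrow> 'f::{zero,finite}) set)"
  using assms by (simp add: nonzero_tuples_def finite_PiE)

lemma card_nonzero_tuples:
  assumes "finite J"
  shows "card (nonzero_tuples J :: ('i \<Rightarrow> 'f::{zero,finite}) set) = CARD('f) ^ card J - 1"
proof -
  have "(nonzero_tuples J :: ('i \<Rightarrow> 'f) set) = (J \<rightarrow>\<^sub>E UNIV) - {\<lambda>i\<in>J. 0}"
    by (auto simp: nonzero_tuples_def PiE_def extensional_def fun_eq_iff)
  then show ?thesis
    using assms by (simp add: card_PiE)
qed

definition partial_expansion ::
    "'x set \<Rightarrow> ('p \<Rightarrow> 'x \<Rightarrow> 'f::comm_ring_1) \<Rightarrow> 'p set \<Rightarrow> ('p \<Rightarrow> 'x \<Rightarrow> 'f) \<Rightarrow> ('i \<Rightarrow> 'x \<Rightarrow> 'f)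
      \<Rightarrow> ('p \<times> 'i) set \<Rightarrow> 'i \<Rightarrow> 'x \<Rightarrow> 'f" where
  "partial_expansion I u B E N A i x = (\<Sum>b\<in>B. of_bool ((b, i) \<in> A) * dot I (u b) (N i) * E b x)"

lemma degree_le_partial_expansion: "degree_le 1 (\<lambda>A. partial_expansion I u B E N A i x)"
  unfolding partial_expansion_def mult.assoc
  by (intro degree_le_sum degree_le_variable_mult_const)

lemma partial_expansion_full:
  assumes "finite B" "separating I u B" "dual_family I u B E" "i \<in> J" "x \<in> I"
  shows "partial_expansion I u B E N (B \<times> J) i x = N i x"
  using dual_family_expansion[OF assms(1-3,5), of "N i"] assms(4)
  by (simp add: partial_expansion_def cong: sum.cong)

lemma dot_partial_expansion_eq_0:
  assumes "dual_family I u B E" "p \<in> B - fst ` A"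
  shows "dot I (u p) (partial_expansion I u B E N A i) = 0"
proof -
  have "dot I (u p) (partial_expansion I u B E N A i)
      = (\<Sum>b\<in>B. of_bool ((b, i) \<in> A) * dot I (u b) (N i) * dot I (u p) (E b))"
    unfolding partial_expansion_def by (rule dot_sum_right)
  also have "\<dots> = 0"
    using assms by (intro sum.neutral) (force simp: dual_family_def)
  finally show ?thesis .
qed

definition lead_index :: "(nat \<Rightarrow> 'f::zero) \<Rightarrow> nat" where
  "lead_index c = (LEAST i. c i \<noteq> 0)"

lemma lead_index_nonzero_tuples:
  assumes "c \<in> nonzero_tuples {..<d}"
  shows "lead_index c < d" "c (lead_index c) \<noteq> 0"
proof -
  obtain i where "i < d" "c i \<noteq> 0"
    using assms by (auto simp: nonzero_tuples_def)
  then show "lead_index c < d" "c (lead_index c) \<noteq> 0"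
    unfolding lead_index_def by (metis (mono_tags) LeastI Least_le le_less_trans)+
qed

lemma eq_0_below_lead_index: "i < lead_index c \<Longrightarrow> c i = 0"
  unfolding lead_index_def by (blast dest: not_less_Least)

lemma det_top_block_full_expansion_neq_0:
  fixes c :: "nat \<Rightarrow> 'f::field"
  assumes B: "finite B" "separating (entries n) u B" "dual_family (entries n) u B E"
    and c: "c \<in> nonzero_tuples {..<d}"
  shows "det (top_block (lead_index c) (n - d)
    (\<lambda>x. \<Sum>i<d. c i * partial_expansion (entries n) u B E shift_matrix (B \<times> {..<d}) i x)) \<noteq> 0"
    (is "det (top_block ?s ?m (\<lambda>x. \<Sum>i<d. c i * ?Z i x)) \<noteq> 0")
proof -
  have "(a, ?s + k) \<in> entries n" if "a < ?m" "k < ?m" for a k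
    using that lead_index_nonzero_tuples(1)[OF c] by auto
  then have "top_block ?s ?m (\<lambda>x. \<Sum>i<d. c i * ?Z i x)
      = top_block ?s ?m (\<lambda>x. \<Sum>i<d. c i * shift_matrix i x)"
    unfolding top_block_def
    by (intro eq_matI) (auto intro!: sum.cong simp: partial_expansion_full[OF B])
  then show ?thesis
    using lead_index_nonzero_tuples[OF c]
    by (simp add: det_top_block_shift_combination eq_0_below_lead_index)
qed

lemma obtain_sparse_nonsingular_space:
  fixes u :: "'p \<Rightarrow> nat \<times> nat \<Rightarrow> 'f::{field,finite}"
  assumes B: "finite B" "separating (entries n) u B" "dual_family (entries n) u B E"
  obtains T Z where "finite T" "card T \<le> (CARD('f) ^ d - 1) * (n - d)"
    "\<And>p i. p \<in> B - T \<Longrightarrow> dot (entries n) (u p) (Z i) = 0"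
    "\<And>c. c \<in> nonzero_tuples {..<d} \<Longrightarrow>
      \<exists>s\<le>d. det (top_block s (n - d) (\<lambda>x. \<Sum>i<d. c i * Z i x)) \<noteq> 0"
proof -
  let ?Z = "partial_expansion (entries n) u B E shift_matrix"
    and ?C = "nonzero_tuples {..<d} :: (nat \<Rightarrow> 'f) set" and ?S = "B \<times> {..<d}"
  let ?minor = "\<lambda>c A. det (top_block (lead_index c) (n - d) (\<lambda>x. \<Sum>i<d. c i * ?Z A i x))"
  have degree: "degree_le (n - d) (?minor c)" for c
    unfolding top_block_def
    by (intro degree_le_det degree_le_sum degree_le_const_mult degree_le_partial_expansion)
  obtain A where A: "A \<subseteq> ?S" "card A \<le> card ?C * (n - d)" "\<And>c. c \<in> ?C \<Longrightarrow> ?minor c A \<noteq> 0"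
  proof (rule degree_le_obtain_small_common_nonzero[of ?C "n - d" ?minor ?S])
    show "?minor c ?S \<noteq> 0" if "c \<in> ?C" for c
      by (rule det_top_block_full_expansion_neq_0[OF B that])
  qed (use B(1) degree in \<open>simp_all add: finite_nonzero_tuples\<close>)
  then have "finite A" using B(1) finite_subset by blast
  have T: "finite (fst ` A)" "card (fst ` A) \<le> (CARD('f) ^ d - 1) * (n - d)"
    using \<open>finite A\<close> card_image_le[OF \<open>finite A\<close>, of fst] A(2)
    by (simp_all add: card_nonzero_tuples)
  have nonsingular: "\<exists>s\<le>d. det (top_block s (n - d) (\<lambda>x. \<Sum>i<d. c i * ?Z A i x)) \<noteq> 0"
    if "c \<in> ?C" for c
    using A(3)[OF that] lead_index_nonzero_tuples(1)[OF that] by (meson less_imp_le)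
  show ?thesis
    using T dot_partial_expansion_eq_0[OF B(3)] nonsingular by (rule that)
qed

section \<open>Plotkin's bound\<close>

lemma card_vanishing_tuples_ge:
  fixes g :: "'i \<Rightarrow> 'f::{field,finite}"
  assumes "finite J" "x \<in> J" "g x \<noteq> 0"
  shows "CARD('f) ^ card J \<le> CARD('f) * card {c \<in> J \<rightarrow>\<^sub>E UNIV. (\<Sum>i\<in>J. c i * g i) = 0}"
    (is "_ \<le> _ * card ?zero")
proof -
  let ?solve = "\<lambda>c. c(x := - (\<Sum>i\<in>J - {x}. c i * g i) / g x)"
  have "inj_on ?solve (J - {x} \<rightarrow>\<^sub>E UNIV)"
  proof (rule inj_onI)
    fix c c' assume c: "c \<in> J - {x} \<rightarrow>\<^sub>E UNIV" "c' \<in> J - {x} \<rightarrow>\<^sub>E UNIV" "?solve c = ?solve c'"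
    have "c i = c' i" if "i \<in> J - {x}" for i
      using fun_cong[OF c(3), of i] that by simp
    then show "c = c'" by (rule PiE_ext[OF c(1,2)])
  qed
  moreover have "?solve ` (J - {x} \<rightarrow>\<^sub>E UNIV) \<subseteq> ?zero"
    using assms by (auto simp: sum.remove[OF assms(1,2)] PiE_def extensional_def)
  ultimately have "card (J - {x} \<rightarrow>\<^sub>E (UNIV :: 'f set)) \<le> card ?zero"
    using assms(1) by (intro card_inj_on_le[of ?solve]) (simp_all add: finite_PiE)
  then have "CARD('f) * CARD('f) ^ card (J - {x}) \<le> CARD('f) * card ?zero"
    using assms(1) by (simp add: card_PiE)
  then show ?thesis
    by (simp only: card_Suc_Diff1[OF assms(1,2)] flip: power_Suc)
qed

lemma card_nonvanishing_tuples_le: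
  fixes g :: "'i \<Rightarrow> 'f::{field,finite}"
  assumes "finite J"
  shows "CARD('f) * card {c \<in> J \<rightarrow>\<^sub>E UNIV. (\<Sum>i\<in>J. c i * g i) \<noteq> 0}
    \<le> (CARD('f) - 1) * CARD('f) ^ card J"
    (is "_ * card ?nonzero \<le> _")
proof (cases "\<exists>x\<in>J. g x \<noteq> 0")
  case False
  then have "?nonzero = {}" by auto
  then show ?thesis by (simp only: card.empty mult_zero_right zero_le)
next
  case True
  let ?zero = "{c \<in> J \<rightarrow>\<^sub>E UNIV. (\<Sum>i\<in>J. c i * g i) = 0}"
  have "finite (J \<rightarrow>\<^sub>E (UNIV :: 'f set))"
    using assms by (simp add: finite_PiE)
  then have "card ?nonzero + card ?zero = card (J \<rightarrow>\<^sub>E (UNIV :: 'f set))"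
    by (subst card_Un_disjoint[symmetric]) (auto intro: arg_cong[where f = card])
  then have "CARD('f) * card ?nonzero + CARD('f) * card ?zero = CARD('f) * CARD('f) ^ card J"
    using assms by (simp add: card_PiE flip: distrib_left)
  moreover have "CARD('f) ^ card J \<le> CARD('f) * card ?zero"
    using True card_vanishing_tuples_ge[OF assms] by blast
  ultimately show ?thesis
    by (simp add: diff_mult_distrib)
qed

lemma plotkin_bound:
  fixes g :: "'p \<Rightarrow> 'i \<Rightarrow> 'f::{field,finite}"
  assumes "finite J" "finite P"
    and weight: "\<And>c. c \<in> nonzero_tuples J \<Longrightarrow> w \<le> card {p \<in> P. (\<Sum>i\<in>J. c i * g p i) \<noteq> 0}"
  shows "CARD('f) * ((CARD('f) ^ card J - 1) * w) \<le> (CARD('f) - 1) * CARD('f) ^ card J * card P"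
proof -
  let ?C = "nonzero_tuples J :: ('i \<Rightarrow> 'f) set"
  have "(CARD('f) ^ card J - 1) * w = (\<Sum>c\<in>?C. w)"
    using assms(1) by (simp add: card_nonzero_tuples)
  also have "\<dots> \<le> (\<Sum>c\<in>?C. card {p \<in> P. (\<Sum>i\<in>J. c i * g p i) \<noteq> 0})"
    by (intro sum_mono weight)
  also have "\<dots> = (\<Sum>p\<in>P. card {c \<in> ?C. (\<Sum>i\<in>J. c i * g p i) \<noteq> 0})"
    using assms(1,2) by (intro sum_multicount_gen) (auto simp: finite_nonzero_tuples)
  finally have "CARD('f) * ((CARD('f) ^ card J - 1) * w)
      \<le> (\<Sum>p\<in>P. CARD('f) * card {c \<in> ?C. (\<Sum>i\<in>J. c i * g p i) \<noteq> 0})"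
    by (simp flip: sum_distrib_left)
  also have "\<dots> \<le> (\<Sum>p\<in>P. CARD('f) * card {c \<in> J \<rightarrow>\<^sub>E UNIV. (\<Sum>i\<in>J. c i * g p i) \<noteq> 0})"
    using assms(1)
    by (intro sum_mono mult_le_mono2 card_mono) (auto simp: nonzero_tuples_def finite_PiE)
  also have "\<dots> \<le> (\<Sum>p\<in>P. (CARD('f) - 1) * CARD('f) ^ card J)"
    by (intro sum_mono card_nonvanishing_tuples_le assms(1))
  finally show ?thesis by (simp add: mult.commute)
qed

section \<open>Bilinear algorithms for the matrix product\<close>

definition independent_columns :: "nat \<Rightarrow> nat set \<Rightarrow> (nat \<times> nat \<Rightarrow> 'f::comm_ring_1) \<Rightarrow> bool" where
  "independent_columns n S Z \<longleftrightarrow>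
     (\<forall>y. (\<forall>i<n. (\<Sum>k\<in>S. Z (i, k) * y k) = 0) \<longrightarrow> (\<forall>k\<in>S. y k = 0))"

lemma independent_columns_if_det_top_block:
  fixes Z :: "nat \<times> nat \<Rightarrow> 'f::idom"
  assumes "m \<le> n" "det (top_block s m Z) \<noteq> 0"
  shows "independent_columns n {s..<s + m} Z"
  unfolding independent_columns_def
proof (intro allI impI)
  fix y :: "nat \<Rightarrow> 'f"
  assume zero: "\<forall>i<n. (\<Sum>k\<in>{s..<s + m}. Z (i, k) * y k) = 0"
  let ?y = "vec m (\<lambda>k. y (s + k))"
  have "top_block s m Z *\<^sub>v ?y = 0\<^sub>v m"
  proof (rule eq_vecI)
    fix i assume "i < dim_vec (0\<^sub>v m)"
    then have "i < m" by simp
    then have "(top_block s m Z *\<^sub>v ?y) $ i = (\<Sum>k\<in>{s..<s + m}. Z (i, k) * y k)"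
      by (simp add: top_block_def scalar_prod_def sum.atLeastLessThan_shift_0[of _ s])
    then show "(top_block s m Z *\<^sub>v ?y) $ i = 0\<^sub>v m $ i"
      using zero \<open>i < m\<close> assms(1) by simp
  qed (simp add: top_block_def)
  moreover have "top_block s m Z \<in> carrier_mat m m"
    by (simp add: top_block_def)
  ultimately have "?y = 0\<^sub>v m"
    using assms(2) det_0_iff_vec_prod_zero vec_carrier by metis
  then have "y (s + k) = 0" if "k < m" for k
    using that by (metis index_vec index_zero_vec(1))
  then show "\<forall>k\<in>{s..<s + m}. y k = 0"
    by (metis add_diff_inverse_nat atLeastLessThan_iff nat_add_left_cancel_less not_less)
qed

text \<open>The \<open>p\<close>-th product is \<open>(\<Sum>x. u p x * X x) * (\<Sum>y. v p y * Y y)\<close>, and \<open>w p (i, j)\<close> is its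
  coefficient in the entry \<open>(i, j)\<close> of \<open>XY\<close>.\<close>

locale mat_prod_algorithm =
  fixes n :: nat and P :: "'p set" and u v w :: "'p \<Rightarrow> nat \<times> nat \<Rightarrow> 'f::field"
  assumes finite_P: "finite P"
    and decomposition: "\<lbrakk>i < n; j < n; a < n; b < n; c < n; e < n\<rbrakk> \<Longrightarrow>
      (\<Sum>p\<in>P. w p (i, j) * u p (a, b) * v p (c, e)) = of_bool (a = i \<and> b = c \<and> e = j)"
begin

lemma mat_prod_eq:
  assumes "i < n" "j < n"
  shows "(\<Sum>p\<in>P. w p (i, j) * dot (entries n) (u p) X * dot (entries n) (v p) Y)
    = (\<Sum>k<n. X (i, k) * Y (k, j))"
proof -
  have "(\<Sum>p\<in>P. w p (i, j) * dot (entries n) (u p) X * dot (entries n) (v p) Y)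
      = (\<Sum>p\<in>P. \<Sum>x\<in>entries n. \<Sum>y\<in>entries n. w p (i, j) * u p x * v p y * (X x * Y y))"
    by (simp add: dot_def sum_distrib_left sum_distrib_right mult_ac)
  also have "\<dots> = (\<Sum>x\<in>entries n. \<Sum>p\<in>P. \<Sum>y\<in>entries n. w p (i, j) * u p x * v p y * (X x * Y y))"
    by (rule sum.swap)
  also have "\<dots> = (\<Sum>x\<in>entries n. \<Sum>y\<in>entries n. \<Sum>p\<in>P. w p (i, j) * u p x * v p y * (X x * Y y))"
    by (intro sum.cong refl sum.swap)
  also have "\<dots> = (\<Sum>x\<in>entries n. \<Sum>y\<in>entries n.
      of_bool (fst x = i \<and> snd x = fst y \<and> snd y = j) * (X x * Y y))"
    using assms
    by (intro sum.cong refl) (auto simp: decomposition simp flip: sum_distrib_right)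
  also have "\<dots> = (\<Sum>a<n. \<Sum>b<n. \<Sum>c<n. \<Sum>e<n.
      if e = j then if c = b then if a = i then X (a, b) * Y (c, e) else 0 else 0 else 0)"
    unfolding sum.cartesian_product' by (intro sum.cong refl) auto
  also have "\<dots> = (\<Sum>a<n. if a = i then \<Sum>k<n. X (a, k) * Y (k, j) else 0)"
    using assms by (intro sum.cong refl) (simp split: if_splits)
  also have "\<dots> = (\<Sum>k<n. X (i, k) * Y (k, j))"
    using assms by simp
  finally show ?thesis .
qed

lemma separating_left_factors: "separating (entries n) u P"
  unfolding separating_def
proof (intro allI impI ballI)
  fix Z x
  assume zero: "\<forall>p\<in>P. dot (entries n) (u p) Z = 0" and "x \<in> entries n"
  then obtain i j where x: "x = (i, j)" "i < n" "j < n" by auto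
  have "Z (i, j) = (\<Sum>k<n. Z (i, k) * of_bool (k = j))"
    using x by simp
  also have "\<dots> = (\<Sum>p\<in>P. w p (i, j) * dot (entries n) (u p) Z
      * dot (entries n) (v p) (\<lambda>(k, j). of_bool (k = j)))"
    using x by (subst mat_prod_eq) simp_all
  also have "\<dots> = 0"
    using zero by (intro sum.neutral) simp
  finally show "Z x = 0" by (simp add: x)
qed

lemma card_nonvanishing_ge:
  assumes "S \<subseteq> {..<n}" "independent_columns n S Z"
  shows "n * card S \<le> card {p \<in> P. dot (entries n) (u p) Z \<noteq> 0}" (is "_ \<le> card ?K")
proof (rule ccontr)
  let ?I = "S \<times> {..<n}"
  have "finite S" using assms(1) finite_subset by blast
  assume "\<not> n * card S \<le> card ?K"
  then have "card ?K < card ?I" by (simp add: card_cartesian_product mult.commute)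
  then obtain D where D: "\<exists>x\<in>?I. D x \<noteq> 0" "\<And>p. p \<in> ?K \<Longrightarrow> dot ?I (v p) D = 0"
    using obtain_nonzero_orthogonal[of ?I ?K v] finite_P \<open>finite S\<close> by auto
  define Y where "Y x = of_bool (x \<in> ?I) * D x" for x
  have dot_Y: "dot (entries n) (v p) Y = dot ?I (v p) D" for p
    unfolding dot_def Y_def using assms(1)
    by (intro sum.mono_neutral_cong_right) auto
  have "(\<Sum>k\<in>S. Z (i, k) * D (k, j)) = 0" if "i < n" "j < n" for i j
  proof -
    have "(\<Sum>k\<in>S. Z (i, k) * D (k, j)) = (\<Sum>k<n. Z (i, k) * Y (k, j))"
      using assms(1) that by (intro sum.mono_neutral_cong_left) (auto simp: Y_def)
    also have "\<dots> = (\<Sum>p\<in>P. w p (i, j) * dot (entries n) (u p) Z * dot ?I (v p) D)"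
      using mat_prod_eq[OF that, of Z Y] by (simp add: dot_Y)
    also have "\<dots> = 0"
      using D(2) by (intro sum.neutral) auto
    finally show ?thesis .
  qed
  then have "D (k, j) = 0" if "k \<in> S" "j < n" for k j
    using assms(2)[unfolded independent_columns_def, rule_format, of "\<lambda>k. D (k, j)" k] that by simp
  then show False using D(1) by auto
qed

end

lemma card_Diff_Diff_add_le:
  assumes "finite P" "finite T" "B \<subseteq> P"
  shows "card (P - (B - T)) + card B \<le> card P + card T"
proof -
  have "finite B" using assms(1,3) finite_subset by blast
  then have "card (P - (B - T)) = card P - card (B - T)"
    using assms(3) by (intro card_Diff_subset) auto
  moreover have "card (B - T) \<le> card P"
    using assms(1,3) by (intro card_mono) auto
  moreover have "card B - card T \<le> card (B - T)"
    by (rule diff_card_le_card_Diff[OF assms(2)])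
  ultimately show ?thesis by linarith
qed

lemma mat_prod_algorithm_obtain_code:
  fixes u v w :: "'p \<Rightarrow> nat \<times> nat \<Rightarrow> 'f::{field,finite}"
  assumes "mat_prod_algorithm n P u v w" "d \<le> n"
  obtains R and g :: "'p \<Rightarrow> nat \<Rightarrow> 'f"
    where "finite R" "card R + n * n \<le> card P + (CARD('f) ^ d - 1) * n"
      "\<And>c. c \<in> nonzero_tuples {..<d} \<Longrightarrow> n * (n - d) \<le> card {p \<in> R. (\<Sum>i<d. c i * g p i) \<noteq> 0}"
proof -
  interpret mat_prod_algorithm n P u v w by fact
  obtain B E where B: "B \<subseteq> P" "separating (entries n) u B" "dual_family (entries n) u B E"
    using obtain_separating_dual_family[OF finite_P separating_left_factors] by blast
  have "finite B" using B(1) finite_P finite_subset by blast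
  obtain T Z where T: "finite T" "card T \<le> (CARD('f) ^ d - 1) * (n - d)"
    and vanishing: "\<And>p i. p \<in> B - T \<Longrightarrow> dot (entries n) (u p) (Z i) = 0"
    and nonsingular: "\<And>c. c \<in> nonzero_tuples {..<d} \<Longrightarrow>
      \<exists>s\<le>d. det (top_block s (n - d) (\<lambda>x. \<Sum>i<d. c i * Z i x)) \<noteq> 0"
    by (rule obtain_sparse_nonsingular_space[OF \<open>finite B\<close> B(2,3)]) blast
  let ?R = "P - (B - T)" and ?g = "\<lambda>p i. dot (entries n) (u p) (Z i)"
  have weight: "n * (n - d) \<le> card {p \<in> ?R. (\<Sum>i<d. c i * ?g p i) \<noteq> 0}"
    if c: "c \<in> nonzero_tuples {..<d}" for c
  proof -
    obtain s where "s \<le> d" "det (top_block s (n - d) (\<lambda>x. \<Sum>i<d. c i * Z i x)) \<noteq> 0"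
      using nonsingular[OF c] by blast
    then have "n * card {s..<s + (n - d)}
        \<le> card {p \<in> P. dot (entries n) (u p) (\<lambda>x. \<Sum>i<d. c i * Z i x) \<noteq> 0}"
      using assms(2) by (intro card_nonvanishing_ge independent_columns_if_det_top_block) auto
    moreover have "(\<Sum>i<d. c i * ?g p i) = 0" if "p \<in> B - T" for p
      using vanishing[OF that] by simp
    then have "{p \<in> P. (\<Sum>i<d. c i * ?g p i) \<noteq> 0} = {p \<in> ?R. (\<Sum>i<d. c i * ?g p i) \<noteq> 0}"
      by blast
    ultimately show ?thesis by (simp add: dot_sum_right)
  qed
  have "card ?R + card B \<le> card P + card T"
    using finite_P T(1) B(1) by (rule card_Diff_Diff_add_le)
  moreover have "n * n \<le> card B"
    using card_le_card_separating[OF _ \<open>finite B\<close> B(2)] by simp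
  moreover have "card T \<le> (CARD('f) ^ d - 1) * n"
    using T(2) by (rule order_trans) simp
  ultimately have "card ?R + n * n \<le> card P + (CARD('f) ^ d - 1) * n"
    by linarith
  then show ?thesis using that[of ?R ?g] finite_P weight by blast
qed

lemma mat_prod_algorithm_plotkin_inequality:
  fixes u v w :: "'p \<Rightarrow> nat \<times> nat \<Rightarrow> 'f::{field,finite}"
  assumes "mat_prod_algorithm n P u v w" "d \<le> n"
  defines "q \<equiv> CARD('f)"
  shows "q * ((q ^ d - 1) * (n * (n - d))) + (q - 1) * q ^ d * (n * n)
    \<le> (q - 1) * q ^ d * (card P + (q ^ d - 1) * n)"
proof -
  obtain R and g :: "'p \<Rightarrow> nat \<Rightarrow> 'f"
    where R: "finite R" "card R + n * n \<le> card P + (q ^ d - 1) * n"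
      and weight: "\<And>c. c \<in> nonzero_tuples {..<d} \<Longrightarrow>
        n * (n - d) \<le> card {p \<in> R. (\<Sum>i<d. c i * g p i) \<noteq> 0}"
    unfolding q_def by (rule mat_prod_algorithm_obtain_code[OF assms(1,2)]) blast
  have "q * ((q ^ d - 1) * (n * (n - d))) \<le> (q - 1) * q ^ d * card R"
    unfolding q_def using plotkin_bound[OF _ R(1) weight] by simp
  then have "q * ((q ^ d - 1) * (n * (n - d))) + (q - 1) * q ^ d * (n * n)
      \<le> (q - 1) * q ^ d * (card R + n * n)"
    by (simp add: distrib_left)
  also have "\<dots> \<le> (q - 1) * q ^ d * (card P + (q ^ d - 1) * n)"
    using R(2) by (rule mult_le_mono2)
  finally show ?thesis .
qed

section \<open>Choosing the dimension\<close>

lemma obtain_power_near_sqrt: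
  assumes "2 \<le> q" "1 \<le> n"
  obtains d where "d \<le> n" "real q ^ d \<le> sqrt n" "sqrt n \<le> real q * real q ^ d"
proof -
  have "2 \<le> q\<^sup>2"
    using assms(1) power_mono[OF assms(1), of 2] by simp
  then obtain d where d: "(q\<^sup>2) ^ d \<le> n" "n < (q\<^sup>2) ^ (d + 1)"
    using ex_power_ivl1[of "q\<^sup>2" n] assms(2) by auto
  have "d < 2 ^ d" by (rule less_exp)
  also have "\<dots> \<le> (q\<^sup>2) ^ d" using \<open>2 \<le> q\<^sup>2\<close> by (rule power_mono) simp
  finally have "d \<le> n" using d(1) by linarith
  moreover have "real q ^ d \<le> sqrt n"
    using of_nat_mono[OF d(1), where 'a = real]
    by (intro real_le_rsqrt) (simp add: power_mult[symmetric] mult.commute)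
  moreover have "sqrt n \<le> real q * real q ^ d"
    using of_nat_mono[OF less_imp_le[OF d(2)], where 'a = real]
    by (intro real_le_lsqrt) (simp_all add: power_mult_distrib power_mult[symmetric] mult.commute)
  ultimately show ?thesis by (rule that)
qed

lemma plotkin_inequality_solve:
  fixes q Q r d N :: real
  assumes q: "2 \<le> q" and Q: "1 \<le> Q" "Q \<le> r" "r \<le> q * Q" and d: "0 \<le> d" "d \<le> Q"
    and plotkin: "q * ((Q - 1) * (r\<^sup>2 * (r\<^sup>2 - d))) + (q - 1) * Q * (r\<^sup>2 * r\<^sup>2)
      \<le> (q - 1) * Q * (N + (Q - 1) * r\<^sup>2)"
  shows "(2 + 1 / (q - 1)) * r ^ 4 - (2 * q + 3) * r ^ 3 \<le> N"
proof -
  have "q * r ^ 3 * r \<le> q * r ^ 3 * (q * Q)"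
    using q Q by (intro mult_left_mono) auto
  moreover have "q * r\<^sup>2 * ((Q - 1) * d) \<le> q * r\<^sup>2 * (Q * r)"
    using q Q d by (intro mult_left_mono mult_mono) auto
  moreover have "(q - 1) * Q * r\<^sup>2 * (Q - 1) \<le> (q - 1) * Q * r\<^sup>2 * r"
    using q Q by (intro mult_left_mono) auto
  moreover have "Q * r ^ 3 * ((q - 2) * (q + 1)) \<ge> 0"
    using q Q by simp
  ultimately have "(q - 1) * Q * N \<ge> Q * (2 * q - 1) * r ^ 4 - (q - 1) * Q * (2 * q + 3) * r ^ 3"
    using plotkin by (simp add: algebra_simps power2_eq_square power3_eq_cube power4_eq_xxxx)
  also have "Q * (2 * q - 1) * r ^ 4 - (q - 1) * Q * (2 * q + 3) * r ^ 3
      = (q - 1) * Q * ((2 + 1 / (q - 1)) * r ^ 4 - (2 * q + 3) * r ^ 3)"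
    using q by (simp add: field_simps)
  finally show ?thesis
    using q Q by simp
qed

lemma quadratic_bound_of_plotkin_inequalities:
  fixes q n N :: nat
  assumes "2 \<le> q" "1 \<le> n"
    and plotkin: "\<And>d. d \<le> n \<Longrightarrow> q * ((q ^ d - 1) * (n * (n - d))) + (q - 1) * q ^ d * (n * n)
      \<le> (q - 1) * q ^ d * (N + (q ^ d - 1) * n)"
  shows "real N \<ge> (2 + 1 / (real q - 1)) * real n ^ 2 - (2 * real q + 3) * real n powr (3 / 2)"
proof -
  define r where "r = sqrt (real n)"
  have r2: "real n = r\<^sup>2" by (simp add: r_def)
  obtain d where d: "d \<le> n" "real q ^ d \<le> r" "r \<le> real q * real q ^ d"
    unfolding r_def by (rule obtain_power_near_sqrt[OF assms(1,2)])
  have "d < q ^ d"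
    using less_exp[of d] power_mono[OF assms(1), of d] by linarith
  then have "real d \<le> real q ^ d"
    by (metis less_imp_le of_nat_mono of_nat_power)
  have "1 \<le> q ^ d" using assms(1) by simp
  then have "real q * ((real q ^ d - 1) * (r\<^sup>2 * (r\<^sup>2 - real d)))
      + (real q - 1) * real q ^ d * (r\<^sup>2 * r\<^sup>2)
    \<le> (real q - 1) * real q ^ d * (real N + (real q ^ d - 1) * r\<^sup>2)"
    using of_nat_mono[OF plotkin[OF d(1)], where 'a = real] d(1) assms(1)
    by (simp add: of_nat_diff r2[symmetric])
  then have "(2 + 1 / (real q - 1)) * r ^ 4 - (2 * real q + 3) * r ^ 3 \<le> real N"
    using assms(1) d(2,3) \<open>real d \<le> real q ^ d\<close> by (intro plotkin_inequality_solve) auto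
  moreover have "r ^ 4 = real n ^ 2"
    by (simp add: r2)
  moreover have "r ^ 3 = real n powr (3 / 2)"
    using assms(2) by (simp add: r_def powr_half_sqrt[symmetric] powr_power)
  ultimately show ?thesis by simp
qed

section \<open>Linear and bilinear monomials\<close>

definition linear_monomial :: "'v \<Rightarrow> 'v \<Rightarrow>\<^sub>0 nat" where
  "linear_monomial x = Poly_Mapping.single x 1"

definition bilinear_monomial :: "'v \<Rightarrow> 'v \<Rightarrow> 'v \<Rightarrow>\<^sub>0 nat" where
  "bilinear_monomial x y = linear_monomial x + linear_monomial y"

lemma lookup_linear_monomial: "Poly_Mapping.lookup (linear_monomial x) z = of_bool (x = z)"
  by (simp add: linear_monomial_def lookup_single when_def)

lemma lookup_bilinear_monomial:
  "Poly_Mapping.lookup (bilinear_monomial x y) z = of_bool (x = z) + of_bool (y = z)"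
  by (simp add: bilinear_monomial_def lookup_add lookup_linear_monomial)

lemma linear_monomial_eq_iff: "linear_monomial x = linear_monomial y \<longleftrightarrow> x = y"
  by (metis lookup_linear_monomial of_bool_eq_iff)

lemma bilinear_monomial_eq_iff:
  assumes "a \<in> X" "x \<in> X" "b \<in> Y" "y \<in> Y" "X \<inter> Y = {}"
  shows "bilinear_monomial a b = bilinear_monomial x y \<longleftrightarrow> a = x \<and> b = y"
proof
  assume "bilinear_monomial a b = bilinear_monomial x y"
  then have "of_bool (a = z) + of_bool (b = z) = (of_bool (x = z) + of_bool (y = z) :: nat)" for z
    by (metis lookup_bilinear_monomial)
  moreover have "a \<noteq> y" "b \<noteq> x" "x \<noteq> y" "y \<noteq> x" using assms by auto
  ultimately have "of_bool (a = x) = (1 :: nat)" "of_bool (b = y) = (1 :: nat)"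
    by (metis add.right_neutral add_0 of_bool_eq)+
  then show "a = x \<and> b = y" by (cases "a = x"; cases "b = y") simp_all
qed simp

lemma linear_monomial_neq_bilinear_monomial: "linear_monomial z \<noteq> bilinear_monomial x y"
proof
  assume "linear_monomial z = bilinear_monomial x y"
  then have "of_bool (z = t) = (of_bool (x = t) + of_bool (y = t) :: nat)" for t
    by (metis lookup_linear_monomial lookup_bilinear_monomial)
  from this[of x] this[of y] show False by (auto simp: of_bool_def split: if_splits)
qed

lemma pvar_conv_linear_monomial: "pvar x = Poly_Mapping.single (linear_monomial x) 1"
  by (simp add: pvar_def linear_monomial_def)

lemma lookup_pscale: "Poly_Mapping.lookup (pscale c p) m = c * Poly_Mapping.lookup p m"
  by (simp add: pscale_def map.rep_eq when_def flip: mult_map_scale_conv_mult)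

lemma pscale_mult_left: "pscale c p * q = pscale c (p * q)"
  by (simp add: pscale_def mult.assoc)

lemma pscale_mult_right: "p * pscale c q = pscale c (p * q)"
  by (simp add: pscale_def mult.left_commute)

lemma keys_in_span:
  assumes "p \<in> mpoly.span S" "\<And>s. s \<in> S \<Longrightarrow> Poly_Mapping.keys s \<subseteq> M"
  shows "Poly_Mapping.keys p \<subseteq> M"
  using assms(1)
proof (induction rule: mpoly.span_induct_alt)
  case base
  then show ?case by simp
next
  case (step c s p)
  have "Poly_Mapping.keys (pscale c s) \<subseteq> Poly_Mapping.keys s"
    by (auto simp: in_keys_iff lookup_pscale)
  then show ?case
    using step assms(2) keys_add[of "pscale c s" p] by blast
qed

lemma keys_linear_form:
  assumes "linear_form_in V p"
  shows "Poly_Mapping.keys p \<subseteq> range linear_monomial"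
  using assms unfolding linear_form_in_def
  by (rule keys_in_span) (auto simp: pvar_conv_linear_monomial)

lemma keys_bilinear_product:
  assumes "p \<in> bilinear_products X Y"
  shows "Poly_Mapping.keys p \<subseteq> range (case_prod bilinear_monomial)"
proof -
  obtain \<mu> \<eta> where p: "p = \<mu> * \<eta>" "linear_form_in X \<mu>" "linear_form_in Y \<eta>"
    using assms by (auto simp: bilinear_products_def)
  show ?thesis
  proof
    fix m assume "m \<in> Poly_Mapping.keys p"
    then obtain a b where "m = a + b" "a \<in> Poly_Mapping.keys \<mu>" "b \<in> Poly_Mapping.keys \<eta>"
      using keys_mult[of \<mu> \<eta>] p(1) by blast
    moreover obtain x y where "a = linear_monomial x" "b = linear_monomial y"
      using calculation(2,3) keys_linear_form p(2,3) by blast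
    ultimately have "m = case_prod bilinear_monomial (x, y)"
      by (simp add: bilinear_monomial_def)
    then show "m \<in> range (case_prod bilinear_monomial)" by blast
  qed
qed

lemma linear_form_in_span_bilinear_products_eq_0:
  assumes "linear_form_in V p" "p \<in> mpoly.span (bilinear_products X Y)"
  shows "p = 0"
proof -
  have "Poly_Mapping.keys p \<subseteq> range (case_prod bilinear_monomial)"
    using assms(2) by (rule keys_in_span) (rule keys_bilinear_product)
  then have "Poly_Mapping.keys p \<subseteq> range linear_monomial \<inter> range (case_prod bilinear_monomial)"
    using keys_linear_form[OF assms(1)] by blast
  also have "\<dots> = {}"
    using linear_monomial_neq_bilinear_monomial by fastforce
  finally show ?thesis by simp
qed

lemma lookup_pvar_linear_monomial:
  "Poly_Mapping.lookup (pvar a :: ('v, 'f::field) mpolynomial) (linear_monomial x)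
    = of_bool (a = x)"
  by (simp add: pvar_conv_linear_monomial lookup_single when_def linear_monomial_eq_iff)

lemma lookup_pvar_mult_pvar:
  assumes "a \<in> X" "x \<in> X" "b \<in> Y" "y \<in> Y" "X \<inter> Y = {}"
  shows "Poly_Mapping.lookup (pvar a * pvar b :: ('v, 'f::field) mpolynomial)
    (bilinear_monomial x y) = of_bool (a = x) * of_bool (b = y)"
proof -
  have "pvar a * pvar b = (Poly_Mapping.single (bilinear_monomial a b) 1 :: ('v, 'f) mpolynomial)"
    by (simp add: pvar_conv_linear_monomial bilinear_monomial_def mult_single)
  then show ?thesis
    using bilinear_monomial_eq_iff[OF assms] by (simp add: lookup_single when_def)
qed

lemma lookup_linear_mult_linear:
  fixes \<mu> \<eta> :: "('v, 'f::field) mpolynomial"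
  assumes \<mu>: "linear_form_in X \<mu>" and \<eta>: "linear_form_in Y \<eta>"
    and xy: "x \<in> X" "y \<in> Y" "X \<inter> Y = {}"
  shows "Poly_Mapping.lookup (\<mu> * \<eta>) (bilinear_monomial x y)
    = Poly_Mapping.lookup \<mu> (linear_monomial x) * Poly_Mapping.lookup \<eta> (linear_monomial y)"
proof -
  have pvar_mult: "Poly_Mapping.lookup (pvar a * \<eta>) (bilinear_monomial x y)
      = of_bool (a = x) * Poly_Mapping.lookup \<eta> (linear_monomial y)" if "a \<in> X" for a
    using \<eta>[unfolded linear_form_in_def]
  proof (induction rule: mpoly.span_induct_alt)
    case base
    then show ?case by simp
  next
    case (step c b q)
    then show ?case
      using that xy
      by (auto simp: distrib_left pscale_mult_right lookup_add lookup_pscale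
          lookup_pvar_mult_pvar[of _ X _ _ Y] lookup_pvar_linear_monomial)
  qed
  show ?thesis
    using \<mu>[unfolded linear_form_in_def]
  proof (induction rule: mpoly.span_induct_alt)
    case base
    then show ?case by simp
  next
    case (step c a p)
    then show ?case
      by (auto simp: distrib_right pscale_mult_left lookup_add lookup_pscale pvar_mult
          lookup_pvar_linear_monomial)
  qed
qed

section \<open>Rank of the matrix product\<close>

lemma lookup_mat_prod_entry:
  assumes "b \<in> {1..n}"
  shows "Poly_Mapping.lookup (mat_prod_entry n i j :: (mat_var, 'f::field) mpolynomial)
      (bilinear_monomial (XVar a b) (YVar c e)) = of_bool (a = i \<and> b = c \<and> e = j)"
proof -
  have "Poly_Mapping.lookup (mat_prod_entry n i j :: (mat_var, 'f) mpolynomial)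
      (bilinear_monomial (XVar a b) (YVar c e))
      = (\<Sum>k = 1..n. of_bool (XVar i k = XVar a b) * of_bool (YVar k j = YVar c e))"
    unfolding mat_prod_entry_def lookup_sum
    by (intro sum.cong refl
        lookup_pvar_mult_pvar[of _ "range (case_prod XVar)" _ _ "range (case_prod YVar)"])
      auto
  also have "\<dots> = (\<Sum>k = 1..n. if k = b then of_bool (a = i \<and> b = c \<and> e = j) else 0)"
    by (intro sum.cong refl) auto
  also have "\<dots> = of_bool (a = i \<and> b = c \<and> e = j)"
    using assms by simp
  finally show ?thesis .
qed

lemma obtain_mat_prod_coefficients:
  fixes P :: "(mat_var, 'f::field) mpolynomial set"
  assumes "finite P" "mat_prod_forms n \<subseteq> mpoly.span P"
  obtains g where "\<And>i j. i < n \<Longrightarrow> j < n \<Longrightarrow>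
    mat_prod_entry n (Suc i) (Suc j) = (\<Sum>p\<in>P. pscale (g i j p) p)"
proof -
  have "\<exists>g. mat_prod_entry n (Suc i) (Suc j) = (\<Sum>p\<in>P. pscale (g p) p)" if "i < n" "j < n" for i j
  proof -
    have "mat_prod_entry n (Suc i) (Suc j) \<in> (mat_prod_forms n :: (mat_var, 'f) mpolynomial set)"
      using that by (force simp: mat_prod_forms_def)
    then show ?thesis
      using assms(2) by (auto simp: mpoly.span_finite[OF assms(1)])
  qed
  then show ?thesis using that by metis
qed

lemma obtain_mat_prod_algorithm:
  fixes P :: "(mat_var, 'f::field) mpolynomial set"
  assumes P: "P \<subseteq> bilinear_products (x_vars n) (y_vars n)" "finite P"
    and span: "mat_prod_forms n \<subseteq> mpoly.span P"
  obtains u v w :: "(mat_var, 'f) mpolynomial \<Rightarrow> nat \<times> nat \<Rightarrow> 'f"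
    where "mat_prod_algorithm n P u v w"
proof -
  have "\<forall>p\<in>P. \<exists>\<mu> \<eta>. p = \<mu> * \<eta> \<and> linear_form_in (x_vars n) \<mu> \<and> linear_form_in (y_vars n) \<eta>"
    using P(1) by (auto simp: bilinear_products_def)
  then obtain \<mu> \<eta> where factors: "\<And>p. p \<in> P \<Longrightarrow> p = \<mu> p * \<eta> p"
    "\<And>p. p \<in> P \<Longrightarrow> linear_form_in (x_vars n) (\<mu> p)" "\<And>p. p \<in> P \<Longrightarrow> linear_form_in (y_vars n) (\<eta> p)"
    by metis
  obtain g where entry: "\<And>i j. i < n \<Longrightarrow> j < n \<Longrightarrow>
      mat_prod_entry n (Suc i) (Suc j) = (\<Sum>p\<in>P. pscale (g i j p) p)"
    using obtain_mat_prod_coefficients[OF P(2) span] by blast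
  let ?u = "\<lambda>p (a, b). Poly_Mapping.lookup (\<mu> p) (linear_monomial (XVar (Suc a) (Suc b)))"
    and ?v = "\<lambda>p (c, e). Poly_Mapping.lookup (\<eta> p) (linear_monomial (YVar (Suc c) (Suc e)))"
    and ?w = "\<lambda>p (i, j). g i j p"
  have "mat_prod_algorithm n P ?u ?v ?w"
  proof
    fix i j a b c e
    assume lt: "i < n" "j < n" "a < n" "b < n" "c < n" "e < n"
    let ?x = "XVar (Suc a) (Suc b)" and ?y = "YVar (Suc c) (Suc e)"
    let ?m = "bilinear_monomial ?x ?y"
    have "Poly_Mapping.lookup p ?m = ?u p (a, b) * ?v p (c, e)" if "p \<in> P" for p
      using lookup_linear_mult_linear[OF factors(2,3)[OF that], of ?x ?y] factors(1)[OF that] lt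
      by (auto simp: x_vars_def y_vars_def)
    then have "(\<Sum>p\<in>P. ?w p (i, j) * ?u p (a, b) * ?v p (c, e))
        = Poly_Mapping.lookup (mat_prod_entry n (Suc i) (Suc j)) ?m"
      by (simp add: entry[OF lt(1,2)] lookup_sum lookup_pscale mult.assoc)
    also have "\<dots> = of_bool (a = i \<and> b = c \<and> e = j)"
      using lt by (simp add: lookup_mat_prod_entry)
    finally show "(\<Sum>p\<in>P. ?w p (i, j) * ?u p (a, b) * ?v p (c, e))
        = of_bool (a = i \<and> b = c \<and> e = j)" .
  qed (fact P(2))
  then show ?thesis by (rule that)
qed

lemma two_le_card_field: "2 \<le> CARD('f::{field,finite})"
proof -
  have "card {0, 1 :: 'f} \<le> CARD('f)" by (rule card_mono) simp_all
  then show ?thesis by simp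
qed

lemma bilinear_rank_mat_prod_ge:
  assumes "n \<ge> 1"
  defines "q \<equiv> real CARD('f::{field,finite})"
  shows "real (bilinear_rank (x_vars n) (y_vars n)
      (mat_prod_forms n :: (mat_var, 'f) mpolynomial set))
    \<ge> (2 + 1 / (q - 1)) * real n ^ 2 - (2 * q + 3) * real n powr (3 / 2)"
proof -
  let ?F = "mat_prod_forms n :: (mat_var, 'f) mpolynomial set"
  have "\<exists>P. P \<subseteq> bilinear_products (x_vars n) (y_vars n) \<and> finite P \<and>
      card P = bilinear_rank (x_vars n) (y_vars n) ?F \<and> ?F \<subseteq> mpoly.span P"
    unfolding bilinear_rank_def
    by (rule LeastI_ex) (use mat_prod_forms_finite_rank in blast)
  then obtain P where P: "P \<subseteq> bilinear_products (x_vars n) (y_vars n)" "finite P"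
      "?F \<subseteq> mpoly.span P"
    and rank: "card P = bilinear_rank (x_vars n) (y_vars n) ?F"
    by blast
  obtain u v w :: "(mat_var, 'f) mpolynomial \<Rightarrow> nat \<times> nat \<Rightarrow> 'f"
    where "mat_prod_algorithm n P u v w"
    using P by (rule obtain_mat_prod_algorithm)
  then show ?thesis
    unfolding q_def rank[symmetric]
    using assms(1) two_le_card_field mat_prod_algorithm_plotkin_inequality
    by (intro quadratic_bound_of_plotkin_inequalities) auto
qed

section \<open>Circuits\<close>

lemma node_poly_in_span:
  assumes G: "arith_circuit V G" and v: "v \<in> verts (dag G)"
  shows "node_poly G v \<in>
    mpoly.span (node_poly G ` {v \<in> verts (dag G). label G v = ProdGate} \<union> pvar ` V)"
    (is "_ \<in> mpoly.span ?S")
proof -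
  interpret fin_digraph "dag G" using G by (simp add: arith_circuit_def)
  have "finite (arcs_ends (dag G))" by (simp add: arcs_ends_def)
  then have "wf (arcs_ends (dag G))" using G by (simp add: arith_circuit_def finite_acyclic_wf)
  then show ?thesis
    using v
  proof (induction v)
    case (less v)
    have label: "if in_arcs (dag G) v = {} then label G v \<in> Input ` V
        else label G v \<in> {SumGate, ProdGate}"
      using G less.prems unfolding arith_circuit_def by blast
    show ?case
    proof (cases "label G v")
      case (Input z)
      then have "node_poly G v = pvar z" "z \<in> V"
        using label node_poly_eq[OF G, of v] by (auto split: if_splits)
      then show ?thesis by (auto intro: mpoly.span_base)
    next
      case ProdGate
      then show ?thesis using less.prems by (auto intro: mpoly.span_base)
    next
      case SumGate
      have "node_poly G (tail (dag G) e) \<in> mpoly.span ?S" if "e \<in> in_arcs (dag G) v" for e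
        using that less.IH[of "tail (dag G) e"] by (auto simp: arcs_ends_conv)
      then show ?thesis
        unfolding node_poly_eq[OF G, of v] SumGate
        by (auto intro!: mpoly.span_sum mpoly.span_scale)
    qed
  qed
qed

lemma prod_gate_in_bilinear_products:
  assumes "bilinear_circuit X Y G" "v \<in> verts (dag G)" "label G v = ProdGate"
  shows "node_poly G v \<in> bilinear_products X Y"
proof -
  obtain e e' where arcs: "e \<noteq> e'" "in_arcs (dag G) v = {e, e'}"
    and factors: "linear_form_in X (pscale (const G e) (node_poly G (tail (dag G) e)))"
      "linear_form_in Y (pscale (const G e') (node_poly G (tail (dag G) e')))"
    using assms unfolding bilinear_circuit_def by blast
  have "arith_circuit (X \<union> Y) G" using assms(1) by (simp add: bilinear_circuit_def)
  then have "node_poly G v = pscale (const G e) (node_poly G (tail (dag G) e))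
      * pscale (const G e') (node_poly G (tail (dag G) e'))"
    using node_poly_eq[of "X \<union> Y" G v] arcs assms(3) by simp
  then show ?thesis using factors by (auto simp: bilinear_products_def)
qed

lemma bilinear_rank_le_card:
  assumes "P \<subseteq> bilinear_products X Y" "finite P" "F \<subseteq> mpoly.span P"
  shows "bilinear_rank X Y F \<le> card P"
  unfolding bilinear_rank_def using assms by (intro Least_le) blast

lemma bilinear_rank_le_num_prod_gates:
  assumes G: "bilinear_circuit X Y G" "computes G F" and F: "F \<subseteq> mpoly.span (bilinear_products X Y)"
  shows "bilinear_rank X Y F \<le> num_prod_gates G"
proof -
  let ?gates = "{v \<in> verts (dag G). label G v = ProdGate}"
  let ?P = "node_poly G ` ?gates"
  have circuit: "arith_circuit (X \<union> Y) G" using G(1) by (simp add: bilinear_circuit_def)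
  then have "finite ?gates"
    by (simp add: arith_circuit_def fin_digraph.finite_verts)
  have products: "?P \<subseteq> bilinear_products X Y"
    using prod_gate_in_bilinear_products[OF G(1)] by auto
  have "f \<in> mpoly.span ?P" if "f \<in> F" for f
  proof -
    have "f \<in> mpoly.span (?P \<union> pvar ` (X \<union> Y))"
      using that G(2) node_poly_in_span[OF circuit] by (auto simp: computes_def)
    then obtain p l where f: "f = p + l" and p: "p \<in> mpoly.span ?P"
      and l: "linear_form_in (X \<union> Y) l"
      by (auto simp: mpoly.span_Un linear_form_in_def)
    have "f - p \<in> mpoly.span (bilinear_products X Y)"
      using that F p mpoly.span_mono[OF products] by (intro mpoly.span_diff) auto
    then have "l = 0"
      using l by (intro linear_form_in_span_bilinear_products_eq_0) (auto simp: f)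
    then show ?thesis using f p by simp
  qed
  then have "bilinear_rank X Y F \<le> card ?P"
    using products \<open>finite ?gates\<close> by (intro bilinear_rank_le_card) auto
  also have "\<dots> \<le> num_prod_gates G"
    unfolding num_prod_gates_def by (rule card_image_le[OF \<open>finite ?gates\<close>])
  finally show ?thesis .
qed

lemma mat_prod_forms_in_span_bilinear_products:
  "mat_prod_forms n \<subseteq> mpoly.span (bilinear_products (x_vars n) (y_vars n))"
  using mat_prod_forms_finite_rank mpoly.span_mono by blast

lemma UNIV_bit: "UNIV = {0, 1 :: bit}"
  by (auto simp: bit_not_zero_iff)

instance bit :: finite
  by standard (simp add: UNIV_bit)

lemma card_bit: "CARD(bit) = 2"
  by (simp add: UNIV_bit)

theorem theorem1:
  shows "\<exists>C::real. \<forall>n::nat. n \<ge> 1 \<longrightarrow>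
    (\<forall>G :: (nat, nat, mat_var, bit) circuit.
       bilinear_circuit (x_vars n) (y_vars n) G \<and> computes G (mat_prod_forms n) \<longrightarrow>
       real (num_prod_gates G) \<ge> 3 * real n ^ 2 - C * real n powr (5 / 3)) \<and>
    real (bilinear_rank (x_vars n) (y_vars n)
        (mat_prod_forms n :: (mat_var, bit) mpolynomial set))
      \<ge> 3 * real n ^ 2 - C * real n powr (5 / 3)"
proof (intro exI[of _ 7] allI impI)
  fix n :: nat assume "n \<ge> 1"
  let ?F = "mat_prod_forms n :: (mat_var, bit) mpolynomial set"
  let ?bound = "3 * real n ^ 2 - 7 * real n powr (5 / 3)"
  have "real n powr (3 / 2) \<le> real n powr (5 / 3)"
    using \<open>n \<ge> 1\<close> by (intro powr_mono) auto
  then have rank: "real (bilinear_rank (x_vars n) (y_vars n) ?F) \<ge> ?bound"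
    using bilinear_rank_mat_prod_ge[OF \<open>n \<ge> 1\<close>, where 'f = bit] by (simp add: card_bit)
  have "real (num_prod_gates G) \<ge> ?bound"
    if "bilinear_circuit (x_vars n) (y_vars n) G" "computes G ?F"
    for G :: "(nat, nat, mat_var, bit) circuit"
    using bilinear_rank_le_num_prod_gates[OF that mat_prod_forms_in_span_bilinear_products] rank
    by linarith
  with rank show "(\<forall>G :: (nat, nat, mat_var, bit) circuit.
      bilinear_circuit (x_vars n) (y_vars n) G \<and> computes G (mat_prod_forms n) \<longrightarrow>
      real (num_prod_gates G) \<ge> ?bound) \<and> real (bilinear_rank (x_vars n) (y_vars n) ?F) \<ge> ?bound"
    by blast
qed

end
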